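(* Let $s\ge 1$ be an integer. There exists an integer $M$, depending only on $s$, such that for all integers $L\ge 3$ and $k$ with $\max\{s+1,L\}\le k\le s+L$, and all integers $n\ge M$, \[ f_{L,s,k}(n)\ge c_{L,s,2}(n). \]
   Context: For positive integers $L,s,n$: $c_{L,s,2}(n)$ denotes the number of partitions of $n$ all of whose parts lie in $\{s+1,s+2,\ldots,s+L\}$. For positive integers $L,s,k,n$: $f_{L,s,k}(n)$ denotes the number of partitions of $n$ whose smallest part equals $s$, whose largest part is at most $L+s$, and which have no part equal to $k$. *)

theory Defs
  imports Main "HOL-Library.Multiset"
begin

definition partitions :: "nat \<Rightarrow> nat multiset set" where
  "partitions n = {p. (\<forall>i \<in># p. 1 \<le> i) \<and> sum_mset p = n}"

definition c2_count :: "nat \<Rightarrow> nat \<Rightarrow> nat \<Rightarrow> nat" where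
  "c2_count L s n = card {p \<in> partitions n. set_mset p \<subseteq> {s+1..s+L}}"

text \<open>Nonemptiness is required explicitly because \<open>Min {}\<close> and \<open>Max {}\<close> are unspecified.\<close>

definition f_count :: "nat \<Rightarrow> nat \<Rightarrow> nat \<Rightarrow> nat \<Rightarrow> nat" where
  "f_count L s k n = card {p \<in> partitions n. p \<noteq> {#} \<and> Min (set_mset p) = s
                       \<and> Max (set_mset p) \<le> L + s \<and> k \<notin># p}"

end

theory Submission imports Defs Complex_Main begin

text \<open>
  Let \<open>S = {s+1..s+L} - {k}\<close> and let \<open>d n\<close> be the number of partitions of \<open>n\<close> into parts from \<open>S\<close>.
  Sorting by the multiplicity of \<open>k\<close>, respectively of \<open>s\<close>, the claim reads
  \<open>(\<Sum>j\<ge>0. d (n - j * k)) \<le> (\<Sum>i\<ge>1. d (n - i * s))\<close>. As \<open>k > s\<close>, the right-hand sum is denser by a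
  factor of at least \<open>(s + 1) / s\<close>, so it suffices that \<open>d\<close> varies slowly, uniformly in \<open>L\<close> and \<open>k\<close>.

  Slow variation: if \<open>x, x + g \<in> S\<close>, then \<open>d n \<le> d (n - g) + e n\<close>, where \<open>e n\<close> counts the partitions
  without the part \<open>x + g\<close>. These are a negligible fraction: such a partition of a large \<open>n\<close> has either
  a small part of large multiplicity, which can be traded for copies of \<open>x + g\<close>, or a large
  part, which can be written in many ways in terms of \<open>x\<close> and \<open>x + g\<close>; every result arises
  from few partitions. One can take \<open>g = 1\<close>, except for \<open>S = {s+1, s+3}\<close>, where \<open>g = 2\<close>.
\<close>

section \<open>Partitions with parts from a given set, and counting tools\<close>

definition partitions_into :: "nat set \<Rightarrow> nat \<Rightarrow> nat multiset set" where
  "partitions_into S n = {p. set_mset p \<subseteq> S \<and> sum_mset p = n}"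

lemma finite_partitions_into:
  assumes "0 \<notin> S"
  shows "finite (partitions_into S n)"
proof (induction n rule: less_induct)
  case (less n)
  have "partitions_into S n \<subseteq> {{#}} \<union> (\<Union>a\<in>{1..n}. add_mset a ` partitions_into S (n - a))"
  proof
    fix p assume p: "p \<in> partitions_into S n"
    show "p \<in> {{#}} \<union> (\<Union>a\<in>{1..n}. add_mset a ` partitions_into S (n - a))"
    proof (cases p)
      case (add a q)
      then have "a \<in> S" "a + sum_mset q = n" "set_mset q \<subseteq> S"
        using p by (auto simp: partitions_into_def)
      moreover have "a \<noteq> 0" using assms \<open>a \<in> S\<close> by metis
      ultimately have "a \<in> {1..n}" "q \<in> partitions_into S (n - a)"
        by (auto simp: partitions_into_def)
      then show ?thesis using add by blast
    qed simp
  qed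
  moreover have "finite ({{#}} \<union> (\<Union>a\<in>{1..n}. add_mset a ` partitions_into S (n - a)))"
    using less by auto
  ultimately show ?case by (rule finite_subset)
qed

lemma card_times_le_of_inj_on:
  assumes "finite B" "inj_on f (A \<times> {..<t::nat})" "f ` (A \<times> {..<t}) \<subseteq> B"
  shows "t * card A \<le> card B"
proof -
  have "card (A \<times> {..<t}) \<le> card B"
    by (rule card_inj_on_le[OF assms(2,3,1)])
  then show ?thesis by (simp add: card_cartesian_product mult.commute)
qed

text \<open>Used in the contrapositive: a partition of a large number has a part that is at least
  \<open>A\<close> or a part of multiplicity above \<open>c\<close>.\<close>

lemma sum_mset_le_of_bounded:
  fixes p :: "nat multiset"
  assumes "\<forall>b\<in>#p. b < A" "\<forall>b\<in>#p. count p b \<le> c"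
  shows "sum_mset p \<le> A * (A * c)"
proof -
  have "sum_mset p \<le> A * size p"
    using assms(1) by (induction p) auto
  also have "size p = (\<Sum>b\<in>set_mset p. count p b)"
    by (simp add: size_multiset_overloaded_eq)
  also have "\<dots> \<le> card (set_mset p) * c"
    using sum_bounded_above[of "set_mset p" "count p" c] assms(2) by simp
  also have "card (set_mset p) \<le> A"
    using card_mono[of "{..<A}" "set_mset p"] assms(1) by auto
  finally show ?thesis by simp
qed

section \<open>Partitions avoiding a given part are a small fraction\<close>

text \<open>For each \<open>t < T\<close>, trading \<open>y * t\<close> copies of \<open>b\<close>
  for \<open>b * t\<close> copies of \<open>y\<close> keeps the sum. The original has no part
  \<open>y\<close>, so the new multiplicity \<open>b * t\<close> of \<open>y\<close> reveals
  \<open>t\<close>, and the trade can be undone.\<close>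

lemma card_partitions_trade_part:
  assumes "0 \<notin> S" "y \<in> S" "b \<in> S" "b \<noteq> y"
  shows "T * card {p \<in> partitions_into (S - {y}) n. y * T \<le> count p b} \<le> card (partitions_into S n)"
proof (rule card_times_le_of_inj_on)
  define f where "f = (\<lambda>(p, t). p - replicate_mset (y * t) b + replicate_mset (b * t) y)"
  let ?A = "{p \<in> partitions_into (S - {y}) n. y * T \<le> count p b}"
  show "finite (partitions_into S n)" using assms(1) by (rule finite_partitions_into)
  have b: "b > 0" using assms(1,3) by (metis gr0I)
  have sub: "replicate_mset (y * t) b \<subseteq># p" if "p \<in> ?A" "t < T" for p t
  proof -
    have "y * t \<le> y * T" using that by simp
    then have "y * t \<le> count p b" using that(1) by (metis (lifting) le_trans mem_Collect_eq)
    then show ?thesis by (simp add: count_le_replicate_mset_subset_eq)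
  qed
  show "f ` (?A \<times> {..<T}) \<subseteq> partitions_into S n"
  proof clarsimp
    fix p t assume p: "p \<in> partitions_into (S - {y}) n" "y * T \<le> count p b" and t: "t < T"
    then have s: "replicate_mset (y * t) b \<subseteq># p" using sub by simp
    then obtain r where r: "p = replicate_mset (y * t) b + r"
      by (metis subset_mset.add_diff_inverse)
    then have "f (p, t) = r + replicate_mset (b * t) y" by (simp add: f_def)
    then have "sum_mset (f (p, t)) = n"
      using p(1) r by (simp add: partitions_into_def mult.commute mult.left_commute)
    moreover have "set_mset (f (p, t)) \<subseteq> S"
      using p(1) assms(2) by (auto simp: f_def partitions_into_def dest: in_diffD split: if_splits)
    ultimately show "f (p, t) \<in> partitions_into S n" by (simp add: partitions_into_def)
  qed
  show "inj_on f (?A \<times> {..<T})"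
  proof (rule inj_onI)
    fix z z' assume z: "z \<in> ?A \<times> {..<T}" and z': "z' \<in> ?A \<times> {..<T}" and eq': "f z = f z'"
    obtain p t p' t' where [simp]: "z = (p, t)" "z' = (p', t')" by (cases z, cases z')
    have p: "p \<in> ?A" "t < T" and p': "p' \<in> ?A" "t' < T" and eq: "f (p, t) = f (p', t')"
      using z z' eq' by auto
    have "count p y = 0" "count p' y = 0"
      using p p' by (auto simp: partitions_into_def count_eq_zero_iff)
    then have "b * t = b * t'"
      using arg_cong[OF eq, of "\<lambda>q. count q y"] assms(4) by (simp add: f_def)
    then have "t = t'" using b by simp
    moreover have "p = p'"
      using eq sub[of p t] sub[of p' t'] p p' \<open>t = t'\<close>
      by (auto simp: f_def) (metis subset_mset.diff_add)
    ultimately show "z = z'" by simp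
  qed
qed

text \<open>A large part \<open>a\<close> can be written as \<open>u * x + v * Suc x\<close> in many
  ways, because \<open>Suc x\<close> copies of \<open>x\<close> can be exchanged for
  \<open>x\<close> copies of \<open>Suc x\<close>. Copies of \<open>x\<close> already present would
  hide \<open>u\<close>, so their number, which is below \<open>K\<close>, is stored along with the
  image; this costs the factor \<open>K\<close> on the right.\<close>

lemma card_partitions_split_large_part:
  assumes "0 \<notin> S" "x \<in> S" "Suc x \<in> S"
  shows "T * card {p \<in> partitions_into (S - {Suc x}) n.
            count p x < K \<and> (\<exists>a\<in>#p. x * (x + Suc x * T) \<le> a \<and> x < a)}
         \<le> K * card (partitions_into S n)"
proof -
  let ?a0 = "x * (x + Suc x * T)"
  let ?A = "{p \<in> partitions_into (S - {Suc x}) n. count p x < K \<and> (\<exists>a\<in>#p. ?a0 \<le> a \<and> x < a)}"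
  have x: "x > 0" using assms by (metis gr0I)
  define part where "part p = (SOME a. a \<in># p \<and> ?a0 \<le> a \<and> x < a)" for p :: "nat multiset"
  have part: "part p \<in># p \<and> ?a0 \<le> part p \<and> x < part p" if "p \<in> ?A" for p
    unfolding part_def by (rule someI_ex) (use that in auto)
  define u where "u a t = a div x - a mod x - Suc x * t" for a t
  define v where "v a t = a mod x + x * t" for a t
  \<comment> \<open>The lower bound on \<open>a\<close> gives
    \<open>x + Suc x * T \<le> a div x\<close>, so the truncated subtractions in \<open>u\<close>
    are exact.\<close>
  have uv: "u a t + Suc x * t + a mod x = a div x" if "?a0 \<le> a" "t < T" for a t
  proof -
    have "x + Suc x * T \<le> a div x"
      using that x by (simp add: less_eq_div_iff_mult_less_eq mult.commute)
    moreover have "a mod x < x" using x by simp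
    moreover have "Suc x * t \<le> Suc x * T" using that by (intro mult_le_mono) auto
    ultimately show ?thesis unfolding u_def by linarith
  qed
  have sum_uv: "u a t * x + v a t * Suc x = a" if "?a0 \<le> a" "t < T" for a t
  proof -
    have "u a t * x + v a t * Suc x = (u a t + Suc x * t + a mod x) * x + a mod x"
      unfolding v_def by (simp add: algebra_simps)
    then show ?thesis using uv[OF that] by (simp add: div_mult_mod_eq)
  qed
  txt \<open>The multiplicity of \<open>Suc x\<close> reveals \<open>t\<close> and \<open>part p mod x\<close>; together with the recorded
    \<open>count p x\<close>, the multiplicity of \<open>x\<close> then reveals \<open>part p div x\<close>.\<close>
  define f where "f = (\<lambda>(p, t). (p - {#part p#} + replicate_mset (u (part p) t) x
      + replicate_mset (v (part p) t) (Suc x), count p x))"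
  have "T * card ?A \<le> card (partitions_into S n \<times> {..<K})"
  proof (rule card_times_le_of_inj_on)
    show "finite (partitions_into S n \<times> {..<K})"
      using finite_partitions_into[OF assms(1)] by simp
    show "f ` (?A \<times> {..<T}) \<subseteq> partitions_into S n \<times> {..<K}"
    proof (rule image_subsetI)
      fix z assume z: "z \<in> ?A \<times> {..<T}"
      obtain p t where [simp]: "z = (p, t)" by (cases z)
      have p: "p \<in> ?A" and t: "t < T" using z by auto
      note pp = part[OF p]
      let ?q = "p - {#part p#} + replicate_mset (u (part p) t) x + replicate_mset (v (part p) t) (Suc x)"
      have "sum_mset p = a + sum_mset (p - {#a#})" if "a \<in># p" for a
        using multi_member_split[OF that] by auto
      then have "sum_mset p = part p + sum_mset (p - {#part p#})" using pp by blast
      moreover have "sum_mset ?q = sum_mset (p - {#part p#}) + (u (part p) t * x + v (part p) t * Suc x)"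
        by (simp only: sum_mset.union sum_mset_replicate_mset of_nat_id add.assoc)
      ultimately have "sum_mset ?q = n"
        using sum_uv[of "part p" t] pp t p by (simp add: partitions_into_def)
      moreover have "set_mset ?q \<subseteq> S"
        using p assms(2,3) by (auto simp: partitions_into_def dest: in_diffD split: if_splits)
      ultimately show "f z \<in> partitions_into S n \<times> {..<K}"
        using p by (simp add: f_def partitions_into_def)
    qed
    show "inj_on f (?A \<times> {..<T})"
    proof (rule inj_onI)
      fix z z' assume z: "z \<in> ?A \<times> {..<T}" and z': "z' \<in> ?A \<times> {..<T}" and eq: "f z = f z'"
      obtain p t p' t' where [simp]: "z = (p, t)" "z' = (p', t')" by (cases z, cases z')
      have p: "p \<in> ?A" "p' \<in> ?A" and t: "t < T" "t' < T" using z z' by auto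
      let ?a = "part p" and ?a' = "part p'"
      note pp = part[OF p(1)] part[OF p(2)]
      have eq1: "p - {#?a#} + replicate_mset (u ?a t) x + replicate_mset (v ?a t) (Suc x)
          = p' - {#?a'#} + replicate_mset (u ?a' t') x + replicate_mset (v ?a' t') (Suc x)"
        and eq2: "count p x = count p' x"
        using eq by (auto simp: f_def)
      have c0: "count p (Suc x) = 0" "count p' (Suc x) = 0"
        using p by (auto simp: partitions_into_def count_eq_zero_iff)
      have "v ?a t = v ?a' t'"
        using arg_cong[OF eq1, of "\<lambda>q. count q (Suc x)"] c0 by simp
      then have "v ?a t mod x = v ?a' t' mod x" "v ?a t div x = v ?a' t' div x" by auto
      then have m: "?a mod x = ?a' mod x" and tt: "t = t'"
        using x by (auto simp: v_def)
      \<comment> \<open>The removed parts exceed \<open>x\<close>, so removing them leaves the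
        multiplicity of \<open>x\<close> unchanged.\<close>
      have "u ?a t = u ?a' t'"
        using arg_cong[OF eq1, of "\<lambda>q. count q x"] eq2 pp by simp
      then have "?a div x = ?a' div x"
        using uv[of ?a t] uv[of ?a' t'] pp t m tt by simp
      then have a: "?a = ?a'" using m by (metis div_mult_mod_eq)
      then have "p - {#?a#} = p' - {#?a#}" using eq1 tt by simp
      then have "p = p'" using pp a by (metis insert_DiffM)
      then show "z = z'" using tt by simp
    qed
  qed
  then show ?thesis by (simp add: card_cartesian_product mult.commute)
qed


text \<open>Every partition of a large \<open>n\<close> without the part \<open>x + g\<close> lies
  in one of three classes: many copies of \<open>x\<close> (\<open>A1\<close>), few copies of
  \<open>x\<close> but some part at least \<open>B\<close> (\<open>A2\<close>), or a part below
  \<open>B\<close> of multiplicity at least \<open>c\<close> (\<open>A3\<close>). Each class is at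
  most a fraction \<open>1 / (3 * T)\<close> of all partitions. The bound on \<open>n\<close> is
  chosen before \<open>S\<close>, which later gives uniformity in \<open>L\<close> and
  \<open>k\<close>.\<close>

lemma card_partitions_avoiding_part_small:
  assumes "x > 0" "g > 0"
  shows "\<exists>M. \<forall>S n. 0 \<notin> S \<longrightarrow> x \<in> S \<longrightarrow> x + g \<in> S \<longrightarrow> g = 1 \<or> S = {x, x + g} \<longrightarrow> M \<le> n \<longrightarrow>
           T * card (partitions_into (S - {x + g}) n) \<le> card (partitions_into S n)"
proof -
  let ?y = "x + g"
  \<comment> \<open>\<open>K\<close> copies of \<open>x\<close> allow \<open>3 * T\<close> trades. A
    part of size \<open>B\<close> exceeds \<open>x\<close> and splits in \<open>3 * T * K\<close>
    ways, where \<open>K\<close> compensates for the stored multiplicity. \<open>c\<close> copies of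
    a part allow \<open>3 * T * B\<close> trades, where \<open>B\<close> compensates for the union
    over all parts below \<open>B\<close>.\<close>
  define K where "K = ?y * (3 * T)"
  define B where "B = x * (x + Suc x * (3 * T * K)) + x + 1"
  define c where "c = ?y * (3 * T * B)"
  show ?thesis
  proof (intro exI allI impI)
    fix S :: "nat set" and n
    assume S: "0 \<notin> S" "x \<in> S" "?y \<in> S" "g = 1 \<or> S = {x, ?y}" and n: "Suc (B * (B * c)) \<le> n"
    let ?P = "partitions_into (S - {?y}) n" and ?N = "card (partitions_into S n)"
    define A1 where "A1 = {p \<in> ?P. ?y * (3 * T) \<le> count p x}"
    define A2 where "A2 = {p \<in> ?P. count p x < K \<and> (\<exists>a\<in>#p. B \<le> a)}"
    define A3 where "A3 b = {p \<in> ?P. c \<le> count p b}" for b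
    have fin: "finite ?P" using S(1) by (intro finite_partitions_into) auto
    have 1: "3 * T * card A1 \<le> ?N"
      unfolding A1_def using card_partitions_trade_part[OF S(1,3,2)] assms(2) by simp
    have 2: "3 * T * card A2 \<le> ?N"
    proof (cases "g = 1")
      case True
      have "A2 \<subseteq> {p \<in> partitions_into (S - {Suc x}) n. count p x < K \<and>
              (\<exists>a\<in>#p. x * (x + Suc x * (3 * T * K)) \<le> a \<and> x < a)}" (is "_ \<subseteq> ?A")
      proof -
        have "x * (x + Suc x * (3 * T * K)) \<le> a \<and> x < a" if "B \<le> a" for a
          using that unfolding B_def by linarith
        then show ?thesis using True by (auto simp: A2_def)
      qed
      then have "card A2 \<le> card ?A"
        using fin True by (intro card_mono) auto
      then have "3 * T * K * card A2 \<le> 3 * T * K * card ?A" by simp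
      also have "\<dots> \<le> K * ?N"
        using card_partitions_split_large_part[of S x] S True by simp
      finally have "K * (3 * T * card A2) \<le> K * ?N" by (simp add: algebra_simps)
      then show ?thesis using assms by (cases "T = 0") (auto simp: K_def)
    next
      case False
      \<comment> \<open>Here \<open>S = {x, x + g}\<close>, so every part of \<open>p\<close> equals
        \<open>x\<close>, which is below \<open>B\<close>.\<close>
      then have "p \<notin> A2" for p
        using S(4) by (force simp: A2_def B_def partitions_into_def)
      then have "A2 = {}" by blast
      then show ?thesis by simp
    qed
    have 3: "3 * T * card (\<Union>b\<in>S \<inter> {..<B} - {?y}. A3 b) \<le> ?N"
    proof -
      let ?I = "S \<inter> {..<B} - {?y}"
      have "card (\<Union>b\<in>?I. A3 b) \<le> (\<Sum>b\<in>?I. card (A3 b))"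
        by (rule card_UN_le) auto
      then have "B * (3 * T * card (\<Union>b\<in>?I. A3 b)) \<le> (\<Sum>b\<in>?I. 3 * T * B * card (A3 b))"
        by (simp flip: sum_distrib_left)
      also have "\<dots> \<le> (\<Sum>b\<in>?I. ?N)"
        by (intro sum_mono) (use card_partitions_trade_part[OF S(1,3)] in \<open>auto simp: A3_def c_def\<close>)
      also have "\<dots> \<le> B * ?N"
        using card_mono[of "{..<B}" ?I] by auto
      finally show ?thesis by (simp only: mult_le_cancel1) (simp add: B_def)
    qed
    have "?P \<subseteq> A1 \<union> A2 \<union> (\<Union>b\<in>S \<inter> {..<B} - {?y}. A3 b)"
    proof
      fix p assume p: "p \<in> ?P"
      show "p \<in> A1 \<union> A2 \<union> (\<Union>b\<in>S \<inter> {..<B} - {?y}. A3 b)"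
      proof (rule ccontr)
        assume np: "p \<notin> A1 \<union> A2 \<union> (\<Union>b\<in>S \<inter> {..<B} - {?y}. A3 b)"
        then have lt: "\<forall>b\<in>#p. b < B"
          using p by (auto simp: A1_def A2_def K_def not_le)
        have "\<forall>b\<in>#p. count p b \<le> c"
          using np p lt by (fastforce simp: A3_def partitions_into_def)
        then have "sum_mset p \<le> B * (B * c)" using lt by (intro sum_mset_le_of_bounded)
        then show False using p n by (simp add: partitions_into_def)
      qed
    qed
    then have "card ?P \<le> card (A1 \<union> A2 \<union> (\<Union>b\<in>S \<inter> {..<B} - {?y}. A3 b))"
      using fin by (intro card_mono) (auto simp: A1_def A2_def A3_def)
    also have "\<dots> \<le> card A1 + card A2 + card (\<Union>b\<in>S \<inter> {..<B} - {?y}. A3 b)"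
      using card_Un_le[of "A1 \<union> A2"] card_Un_le[of A1 A2] by (meson add_mono le_refl order_trans)
    finally have "3 * T * card ?P \<le> 3 * T * (card A1 + card A2 + card (\<Union>b\<in>S \<inter> {..<B} - {?y}. A3 b))"
      by simp
    also have "\<dots> = 3 * T * card A1 + 3 * T * card A2 + 3 * T * card (\<Union>b\<in>S \<inter> {..<B} - {?y}. A3 b)"
      by (simp add: algebra_simps)
    also have "\<dots> \<le> 3 * ?N" using 1 2 3 by linarith
    finally show "T * card ?P \<le> ?N" by simp
  qed
qed

section \<open>Counting by the multiplicity of one part\<close>

lemma card_partitions_into_count_eq:
  assumes "a \<notin> S" "i * a \<le> n"
  shows "card {p \<in> partitions_into (insert a S) n. count p a = i} = card (partitions_into S (n - i * a))"
proof -
  have "bij_betw (\<lambda>q. q + replicate_mset i a) (partitions_into S (n - i * a))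
          {p \<in> partitions_into (insert a S) n. count p a = i}"
  proof (rule bij_betwI')
    fix q assume q: "q \<in> partitions_into S (n - i * a)"
    then have "count q a = 0" using assms(1) by (auto simp: partitions_into_def count_eq_zero_iff)
    then show "q + replicate_mset i a \<in> {p \<in> partitions_into (insert a S) n. count p a = i}"
      using q assms(2) by (auto simp: partitions_into_def split: if_splits)
  next
    fix p assume p: "p \<in> {p \<in> partitions_into (insert a S) n. count p a = i}"
    then have "replicate_mset i a \<subseteq># p" by (auto simp flip: count_le_replicate_mset_subset_eq)
    then obtain q where q: "p = q + replicate_mset i a" by (metis subset_mset.diff_add)
    moreover have "a \<notin># q" using p q by (auto simp: not_in_iff)
    ultimately have "q \<in> partitions_into S (n - i * a)"
      using p by (auto simp: partitions_into_def)
    then show "\<exists>q\<in>partitions_into S (n - i * a). p = q + replicate_mset i a" using q by blast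
  qed simp
  then show ?thesis by (simp add: bij_betw_same_card)
qed

lemma card_partitions_into_count_in:
  assumes "a \<notin> S" "0 \<notin> S" "a > 0" "finite I" "\<And>i. i \<in> I \<Longrightarrow> i * a \<le> n"
  shows "card {p \<in> partitions_into (insert a S) n. count p a \<in> I}
       = (\<Sum>i\<in>I. card (partitions_into S (n - i * a)))"
proof -
  have "{p \<in> partitions_into (insert a S) n. count p a \<in> I}
      = (\<Union>i\<in>I. {p \<in> partitions_into (insert a S) n. count p a = i})" by auto
  moreover have "finite (partitions_into (insert a S) n)"
    using assms by (intro finite_partitions_into) auto
  moreover from this have "card (\<Union>i\<in>I. {p \<in> partitions_into (insert a S) n. count p a = i})
      = (\<Sum>i\<in>I. card {p \<in> partitions_into (insert a S) n. count p a = i})"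
    using assms(4) by (intro card_UN_disjoint) auto
  ultimately show ?thesis
    using assms by (simp add: card_partitions_into_count_eq)
qed

lemma card_partitions_into_mono:
  assumes "0 \<notin> S" "a \<in> S"
  shows "card (partitions_into S n) \<le> card (partitions_into S (n + a))"
  by (rule card_inj_on_le[where f = "add_mset a"])
     (use assms finite_partitions_into in \<open>auto simp: partitions_into_def inj_on_def\<close>)

lemma card_partitions_into_remove_part:
  assumes "0 \<notin> S" "a \<in> S" "a \<le> n"
  shows "card (partitions_into S n) = card (partitions_into S (n - a)) + card (partitions_into (S - {a}) n)"
proof -
  have "partitions_into S n = add_mset a ` partitions_into S (n - a) \<union> partitions_into (S - {a}) n"
  proof
    show "partitions_into S n \<subseteq> add_mset a ` partitions_into S (n - a) \<union> partitions_into (S - {a}) n"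
    proof
      fix p assume p: "p \<in> partitions_into S n"
      show "p \<in> add_mset a ` partitions_into S (n - a) \<union> partitions_into (S - {a}) n"
      proof (cases "a \<in># p")
        case True
        then obtain q where "p = add_mset a q" by (metis insert_DiffM)
        then show ?thesis using p by (auto simp: partitions_into_def)
      qed (use p in \<open>auto simp: partitions_into_def\<close>)
    qed
    have "add_mset a q \<in> partitions_into S n" if "q \<in> partitions_into S (n - a)" for q
      using that assms(2,3) by (simp add: partitions_into_def)
    moreover have "partitions_into (S - {a}) n \<subseteq> partitions_into S n"
      unfolding partitions_into_def by blast
    ultimately show "add_mset a ` partitions_into S (n - a) \<union> partitions_into (S - {a}) n \<subseteq> partitions_into S n"
      by blast
  qed
  moreover have "add_mset a q \<notin> partitions_into (S - {a}) n" for q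
    by (simp add: partitions_into_def)
  then have "add_mset a ` partitions_into S (n - a) \<inter> partitions_into (S - {a}) n = {}"
    by blast
  moreover have "card (add_mset a ` partitions_into S (n - a)) = card (partitions_into S (n - a))"
    by (intro card_image) (auto simp: inj_on_def)
  moreover have "finite (partitions_into S (n - a))" "finite (partitions_into (S - {a}) n)"
    using assms by (auto intro: finite_partitions_into)
  ultimately show ?thesis by (simp add: card_Un_disjoint)
qed

section \<open>Slow variation of the partition counts\<close>

text \<open>Removing one copy of \<open>x + g\<close> leads from \<open>m\<close> to
  \<open>m - (x + g)\<close>, and adding a copy of \<open>x\<close> leads on to
  \<open>m - g\<close>; only partitions without \<open>x + g\<close> are lost. So one step by
  \<open>g\<close> costs at most a fraction \<open>1 / T\<close>, and Bernoulli's inequality bounds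
  the cost of \<open>w\<close> steps.\<close>

lemma card_partitions_into_smooth:
  assumes "x > 0" "g > 0"
  shows "\<exists>M. \<forall>S n w. 0 \<notin> S \<longrightarrow> x \<in> S \<longrightarrow> x + g \<in> S \<longrightarrow> g = 1 \<or> S = {x, x + g} \<longrightarrow> M \<le> n \<longrightarrow>
           w \<le> 2 * s \<longrightarrow>
           (2 * s + 1) * card (partitions_into S n) \<le> (2 * s + 2) * card (partitions_into S (n - g * w))"
proof -
  \<comment> \<open>Since \<open>2 * s * (2 * s + 2) \<le> T\<close>, at most \<open>2 * s\<close>
    steps lose no more than a fraction \<open>1 / (2 * s + 2)\<close> in total; the extra
    \<open>1\<close> keeps \<open>T\<close> positive.\<close>
  define T where "T = 4 * s * (s + 1) + 1"
  obtain M where M: "\<And>S n. \<lbrakk>0 \<notin> S; x \<in> S; x + g \<in> S; g = 1 \<or> S = {x, x + g}; M \<le> n\<rbrakk> \<Longrightarrow>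
           T * card (partitions_into (S - {x + g}) n) \<le> card (partitions_into S n)"
    using card_partitions_avoiding_part_small[OF assms, of T] by blast
  show ?thesis
  proof (intro exI allI impI)
    fix S :: "nat set" and n w
    assume S: "0 \<notin> S" "x \<in> S" "x + g \<in> S" "g = 1 \<or> S = {x, x + g}"
      and n: "M + x + g + g * (2 * s) \<le> n" and w: "w \<le> 2 * s"
    let ?d = "\<lambda>n. real (card (partitions_into S n))"
    have T: "real T \<ge> 1" by (simp add: T_def)
    have step: "(1 - 1 / T) * ?d m \<le> ?d (m - g)" if m: "M + x + g \<le> m" for m
    proof -
      have "card (partitions_into S m) = card (partitions_into S (m - (x + g))) + card (partitions_into (S - {x + g}) m)"
        using S m by (intro card_partitions_into_remove_part) auto
      moreover have "card (partitions_into S (m - (x + g))) \<le> card (partitions_into S (m - g))"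
        using card_partitions_into_mono[OF S(1,2), of "m - (x + g)"] m by (simp add: algebra_simps)
      ultimately have "?d m \<le> ?d (m - g) + real (card (partitions_into (S - {x + g}) m))" by linarith
      moreover have "real T * real (card (partitions_into (S - {x + g}) m)) \<le> ?d m"
        using M[OF S, of m] m by (metis add_leD1 of_nat_le_iff of_nat_mult)
      then have "real (card (partitions_into (S - {x + g}) m)) \<le> ?d m / T"
        using T by (simp add: field_simps)
      ultimately show ?thesis by (simp add: algebra_simps)
    qed
    have pow: "(1 - 1 / T) ^ v * ?d n \<le> ?d (n - g * v)" if "v \<le> 2 * s" for v
      using that
    proof (induction v)
      case (Suc v)
      have "g * v \<le> g * (2 * s)" using Suc.prems by simp
      then have "M + x + g \<le> n - g * v" using n by linarith
      from step[OF this] have "(1 - 1 / T) * ?d (n - g * v) \<le> ?d (n - g * Suc v)"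
        by (simp add: add.commute)
      moreover have "(1 - 1 / T) * ((1 - 1 / T) ^ v * ?d n) \<le> (1 - 1 / T) * ?d (n - g * v)"
        using Suc T by (intro mult_left_mono) auto
      ultimately show ?case by (simp add: mult.assoc)
    qed simp
    have "1 + real w * (- 1 / T) \<le> (1 + (- 1 / T)) ^ w"
      using T by (intro Bernoulli_inequality) (simp add: field_simps)
    moreover have "real w / T \<le> 1 / (2 * s + 2)"
    proof -
      have "w * (2 * s + 2) \<le> T"
        using mult_le_mono1[OF w, of "2 * s + 2"] by (simp add: T_def algebra_simps)
      then have "real w * (2 * s + 2) \<le> real T" by (metis of_nat_le_iff of_nat_mult)
      then show ?thesis using T by (simp add: field_simps)
    qed
    ultimately have "1 - 1 / (2 * s + 2) \<le> (1 - 1 / T) ^ w" by simp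
    then have "(1 - 1 / (2 * s + 2)) * ?d n \<le> ?d (n - g * w)"
      using pow[OF w] by (meson mult_right_mono of_nat_0_le_iff order_trans)
    then have "real ((2 * s + 1) * card (partitions_into S n)) \<le> real ((2 * s + 2) * card (partitions_into S (n - g * w)))"
      by (simp add: field_simps)
    then show "(2 * s + 1) * card (partitions_into S n) \<le> (2 * s + 2) * card (partitions_into S (n - g * w))"
      using of_nat_le_iff by blast
  qed
qed

section \<open>Comparison of the sums over multiples of \<open>k\<close> and of
  \<open>s\<close>\<close>

text \<open>Matching indices \<open>s + 1\<close> to at most \<open>s\<close> gains a factor
  \<open>(s + 1) / s\<close>, while smoothing loses only \<open>(2 * s + 2) / (2 * s + 1)\<close>.
  The net gain \<open>(2 * s + 1) / (2 * s)\<close> is kept for the exceptional partitions. In the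
  reserve \<open>M + 4 * s\<close>, the summand \<open>M\<close> makes smoothing applicable at
  \<open>n - j * k\<close>, and \<open>4 * s\<close> covers the overshoot
  \<open>g * w\<close>.\<close>

lemma card_partitions_compare_missing_part:
  fixes s k g M :: nat
  assumes s: "s \<ge> 1" "s < k" and g: "g = 1 \<or> g = 2 \<and> k = s + 2"
    and S: "0 \<notin> S" "s \<notin> S" "k \<notin> S"
    and smooth: "\<And>n w. M \<le> n \<Longrightarrow> w \<le> 2 * s \<Longrightarrow>
      (2 * s + 1) * card (partitions_into S n) \<le> (2 * s + 2) * card (partitions_into S (n - g * w))"
  shows "(2 * s + 1) * card {p \<in> partitions_into (insert k S) n. count p k * k + (M + 4 * s) \<le> n}
         \<le> 2 * s * card {p \<in> partitions_into (insert s S) n. s \<in># p}"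
proof -
  let ?d = "\<lambda>n. card (partitions_into S n)"
  define J where "J = {j. j * k + (M + 4 * s) \<le> n}"
  define I where "I = {i. 1 \<le> i \<and> i * s \<le> n}"
  have "J \<subseteq> {..n}"
  proof
    fix j assume "j \<in> J"
    then have "j * k \<le> n" by (simp add: J_def)
    moreover have "j \<le> j * k" using s by simp
    ultimately show "j \<in> {..n}" using le_trans by blast
  qed
  then have finJ: "finite J" by (rule finite_subset) simp
  have "I \<subseteq> {..n}"
  proof
    fix i assume "i \<in> I"
    then have "i * s \<le> n" by (simp add: I_def)
    moreover have "i \<le> i * s" using s by simp
    ultimately show "i \<in> {..n}" using le_trans by blast
  qed
  then have finI: "finite I" by (rule finite_subset) simp
  have cJ: "card {p \<in> partitions_into (insert k S) n. count p k \<in> J} = (\<Sum>j\<in>J. ?d (n - j * k))"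
    using S s finJ by (intro card_partitions_into_count_in) (auto simp: J_def)
  have "{p \<in> partitions_into (insert s S) n. s \<in># p}
      = {p \<in> partitions_into (insert s S) n. count p s \<in> I}"
  proof -
    have "count p s * s \<le> n" if "p \<in> partitions_into (insert s S) n" for p
    proof -
      have "replicate_mset (count p s) s \<subseteq># p"
        by (simp flip: count_le_replicate_mset_subset_eq)
      then obtain q where "p = replicate_mset (count p s) s + q"
        by (metis subset_mset.add_diff_inverse)
      then have "sum_mset p = count p s * s + sum_mset q"
        by (metis of_nat_id sum_mset.union sum_mset_replicate_mset)
      then show ?thesis using that by (simp add: partitions_into_def)
    qed
    then show ?thesis by (auto simp: I_def Suc_le_eq)
  qed
  then have cI: "card {p \<in> partitions_into (insert s S) n. s \<in># p} = (\<Sum>i\<in>I. ?d (n - i * s))"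
    using card_partitions_into_count_in[OF S(2,1) _ finI, of n] s by (simp add: I_def)
  txt \<open>Each \<open>j\<close> is matched with the \<open>s + 1\<close> indices \<open>i j r\<close>, \<open>r \<le> s\<close>, for which \<open>i j r * s\<close> lies slightly
    above \<open>j * k\<close> and in the same class modulo \<open>g\<close>; every index is used at most \<open>s\<close> times, because
    \<open>t j r mod s\<close> separates the pairs sharing it.\<close>
  define t where "t j r = j div g * k + r" for j r
  define i where "i j r = g * (t j r div s + 1) + j mod g" for j r
  have gap: "\<exists>w\<le>2 * s. i j r * s = j * k + g * w" if r: "r \<le> s" for j r
  proof -
    have td: "t j r div s * s + t j r mod s = t j r" by simp
    have tm: "t j r mod s < s" using s by simp
    \<comment> \<open>The distance from \<open>t j r\<close> up to the next multiple of
      \<open>s\<close> strictly above it.\<close>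
    define e where "e = s - t j r mod s"
    have "(t j r div s + 1) * s = t j r div s * s + s" by simp
    then have e: "1 \<le> e" "e \<le> s" "(t j r div s + 1) * s = t j r + e"
      using td tm unfolding e_def by linarith+
    have i_s: "i j r * s = g * (t j r + e) + j mod g * s"
      unfolding e(3)[symmetric] i_def by (simp add: algebra_simps)
    from g show ?thesis
    proof
      assume "g = 1"
      then have "i j r * s = j * k + g * (r + e)" by (simp add: i_s t_def)
      then show ?thesis using e r by (intro exI[of _ "r + e"]) simp
    next
      assume g2: "g = 2 \<and> k = s + 2"
      define a p where "a = j div 2" and "p = j mod 2"
      have p: "p \<le> 1" unfolding p_def by linarith
      \<comment> \<open>For odd \<open>j\<close>, the term \<open>p * k\<close> equals
        \<open>p * s + 2 * p\<close>; the excess \<open>2 * p\<close> is taken out of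
        \<open>2 * (r + e)\<close>. This is possible because \<open>e\<close> is at least
        \<open>1\<close>.\<close>
      obtain w where w: "r + e = w + p" using p e(1) by (metis le_add_diff_inverse2 le_trans trans_le_add2)
      have j: "j = 2 * a + p" by (simp add: a_def p_def)
      have "i j r * s = 2 * (a * k + (w + p)) + p * s"
        using g2 by (simp add: i_s t_def a_def[symmetric] p_def[symmetric] w[symmetric])
      also have "\<dots> = j * k + g * w" using g2 by (simp add: j algebra_simps)
      finally show ?thesis using e r w by (intro exI[of _ w]) simp
    qed
  qed
  have le: "(2 * s + 1) * ?d (n - j * k) \<le> (2 * s + 2) * ?d (n - i j r * s)" and iI: "i j r \<in> I"
    if jr: "j \<in> J" "r \<le> s" for j r
  proof -
    obtain w where w: "w \<le> 2 * s" "i j r * s = j * k + g * w" using gap[OF jr(2)] by blast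
    have "g * w \<le> 2 * (2 * s)" using w g by (intro mult_le_mono) auto
    then show "i j r \<in> I" using jr w g by (auto simp: I_def J_def i_def)
    have "M \<le> n - j * k" using that by (simp add: J_def)
    from smooth[OF this w(1)] show "(2 * s + 1) * ?d (n - j * k) \<le> (2 * s + 2) * ?d (n - i j r * s)"
      using w by simp
  qed
  define \<phi> where "\<phi> = (\<lambda>(j, r). (i j r, t j r mod s))"
  have inj: "inj_on \<phi> (J \<times> {..s})"
  proof (rule inj_onI)
    fix z z' assume z: "z \<in> J \<times> {..s}" and z': "z' \<in> J \<times> {..s}" and eq: "\<phi> z = \<phi> z'"
    obtain j r j' r' where [simp]: "z = (j, r)" "z' = (j', r')" by (cases z, cases z')
    have ii: "i j r = i j' r'" and tm: "t j r mod s = t j' r' mod s" using eq by (auto simp: \<phi>_def)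
    have g0: "g > 0" using g by auto
    have "(g * c + m mod g) mod g = m mod g" "(g * c + m mod g) div g = c" for c m
      using g0 by auto
    then have im: "i j r mod g = j mod g" "i j r div g = t j r div s + 1" for j r
      unfolding i_def by blast+
    have jm: "j mod g = j' mod g" using arg_cong[OF ii, of "\<lambda>y. y mod g"] by (simp only: im)
    have "t j r div s = t j' r' div s" using arg_cong[OF ii, of "\<lambda>y. y div g"] by (simp add: im)
    then have tt: "t j r = t j' r'" using tm by (metis div_mult_mod_eq)
    \<comment> \<open>As \<open>r \<le> s < k\<close>, the summand \<open>r\<close> is the remainder
      of \<open>t j r\<close> modulo \<open>k\<close>.\<close>
    have tk: "t j r div k = j div g" "t j r mod k = r" if "r \<le> s" for j r
      using that s by (auto simp: t_def)
    have "j div g = j' div g" using tk(1)[of r j] tk(1)[of r' j'] tt z z' by simp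
    then have "j = j'" using jm by (metis div_mult_mod_eq)
    moreover have "r = r'" using tk(2)[of r j] tk(2)[of r' j'] tt z z' by simp
    ultimately show "z = z'" by simp
  qed
  have "(\<Sum>z\<in>J \<times> {..s}. ?d (n - fst (\<phi> z) * s)) = (\<Sum>y\<in>\<phi> ` (J \<times> {..s}). ?d (n - fst y * s))"
    using inj by (simp add: sum.reindex)
  also have "\<dots> \<le> (\<Sum>y\<in>I \<times> {..<s}. ?d (n - fst y * s))"
    using finI iI s by (intro sum_mono2) (auto simp: \<phi>_def)
  also have "\<dots> = s * (\<Sum>i\<in>I. ?d (n - i * s))"
    using sum.cartesian_product[of "\<lambda>i _. ?d (n - i * s)" "{..<s}" I]
    by (simp add: split_def sum_distrib_left)
  finally have \<phi>_sum: "(\<Sum>z\<in>J \<times> {..s}. ?d (n - fst (\<phi> z) * s)) \<le> s * (\<Sum>i\<in>I. ?d (n - i * s))" .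
  \<comment> \<open>The factor \<open>s + 1\<close> counts the values of \<open>r\<close>; it
    cancels against \<open>2 * s + 2\<close> at the end.\<close>
  have "(s + 1) * ((2 * s + 1) * (\<Sum>j\<in>J. ?d (n - j * k)))
      = (\<Sum>j\<in>J. \<Sum>r\<le>s. (2 * s + 1) * ?d (n - j * k))"
    by (simp add: sum_distrib_left algebra_simps)
  also have "\<dots> \<le> (\<Sum>j\<in>J. \<Sum>r\<le>s. (2 * s + 2) * ?d (n - i j r * s))"
    by (intro sum_mono le) auto
  also have "\<dots> = (2 * s + 2) * (\<Sum>z\<in>J \<times> {..s}. ?d (n - fst (\<phi> z) * s))"
    by (simp add: sum.cartesian_product sum_distrib_left \<phi>_def split_def)
  also have "\<dots> \<le> (2 * s + 2) * (s * (\<Sum>i\<in>I. ?d (n - i * s)))"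
    using \<phi>_sum by (rule mult_le_mono2)
  also have "\<dots> = (s + 1) * (2 * s * (\<Sum>i\<in>I. ?d (n - i * s)))"
    by (simp add: algebra_simps)
  finally have "(s + 1) * ((2 * s + 1) * (\<Sum>j\<in>J. ?d (n - j * k))) \<le> (s + 1) * (2 * s * (\<Sum>i\<in>I. ?d (n - i * s)))" .
  then have "(2 * s + 1) * (\<Sum>j\<in>J. ?d (n - j * k)) \<le> 2 * s * (\<Sum>i\<in>I. ?d (n - i * s))"
    by (simp only: mult_le_cancel1)
  then show ?thesis using cJ cI by (simp add: J_def)
qed

section \<open>Exceptional partitions are bounded in number, the others are not\<close>

text \<open>Deleting all copies of \<open>a\<close> leaves a partition of some \<open>m < N\<close>,
  and the fixed total \<open>n\<close> tells how many copies to restore. The bound depends on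
  \<open>N\<close> alone.\<close>

lemma card_partitions_into_count_ge:
  assumes "0 \<notin> S"
  shows "card {p \<in> partitions_into S n. n < count p a * a + N} \<le> card (\<Union>m<N. partitions_into {1..} m)"
proof (rule card_inj_on_le)
  let ?A = "{p \<in> partitions_into S n. n < count p a * a + N}"
  have split: "p = {#b \<in># p. b \<noteq> a#} + replicate_mset (count p a) a" for p
    using multiset_partition[of p "\<lambda>b. b \<noteq> a"] by (simp add: filter_eq_replicate_mset)
  have sum: "sum_mset p = sum_mset {#b \<in># p. b \<noteq> a#} + count p a * a" for p
    using arg_cong[OF split[of p], of sum_mset] by simp
  show "finite (\<Union>m<N. partitions_into {1..} m)"
    by (auto intro!: finite_partitions_into)
  show "filter_mset (\<lambda>b. b \<noteq> a) ` ?A \<subseteq> (\<Union>m<N. partitions_into {1..} m)"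
  proof (rule image_subsetI)
    fix p assume p: "p \<in> ?A"
    have "sum_mset {#b \<in># p. b \<noteq> a#} < N" using p sum[of p] by (simp add: partitions_into_def)
    moreover have "set_mset {#b \<in># p. b \<noteq> a#} \<subseteq> {1..}"
      using p assms by (auto simp: partitions_into_def Suc_le_eq intro!: gr0I)
    ultimately show "filter_mset (\<lambda>b. b \<noteq> a) p \<in> (\<Union>m<N. partitions_into {1..} m)"
      by (auto simp: partitions_into_def)
  qed
  show "inj_on (filter_mset (\<lambda>b. b \<noteq> a)) ?A"
  proof (rule inj_onI)
    fix p q assume p: "p \<in> ?A" and q: "q \<in> ?A" and eq: "{#b \<in># p. b \<noteq> a#} = {#b \<in># q. b \<noteq> a#}"
    have "sum_mset p = sum_mset q" using p q by (simp add: partitions_into_def)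
    then have "count p a * a = count q a * a"
      using sum[of p] sum[of q] arg_cong[OF eq, of sum_mset] by linarith
    then have "replicate_mset (count p a) a = replicate_mset (count q a) a"
    proof (cases "a = 0")
      case True
      then have "a \<notin># p" "a \<notin># q" using p q assms by (auto simp: partitions_into_def)
      then show ?thesis by (simp add: not_in_iff)
    qed simp
    then show "p = q" using split[of p] split[of q] eq by metis
  qed
qed

text \<open>Partitions using only \<open>x\<close> and \<open>Suc x\<close> suffice: there are many
  once \<open>n\<close> is large, and they can be chosen so that the copies of \<open>x\<close> and
  the copies of \<open>Suc x\<close> each sum to at least \<open>N\<close>. Whatever
  \<open>k\<close> is, one of these two blocks survives the deletion of all copies of
  \<open>k\<close>.\<close>

lemma card_partitions_into_unbounded:
  assumes "x > 0"
  shows "\<exists>M. \<forall>S k n. 0 \<notin> S \<longrightarrow> x \<in> S \<longrightarrow> Suc x \<in> S \<longrightarrow> M \<le> n \<longrightarrow>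
           Q \<le> card {p \<in> partitions_into S n. count p k * k + N \<le> n}"
proof (intro exI allI impI)
  fix S :: "nat set" and k n
  assume S: "0 \<notin> S" "x \<in> S" "Suc x \<in> S" and n: "x * (x + Suc x * (N + Q) + N) \<le> n"
  \<comment> \<open>Shifting \<open>t\<close> by \<open>N\<close> makes \<open>v t\<close> at least
    \<open>N\<close>; the last summand \<open>N\<close> in the factor of the bound on
    \<open>n\<close> does the same for \<open>u t\<close>.\<close>
  define v where "v t = n mod x + x * (N + t)" for t
  define u where "u t = n div x - n mod x - Suc x * (N + t)" for t
  define f where "f t = replicate_mset (u t) x + replicate_mset (v t) (Suc x)" for t
  let ?A = "{p \<in> partitions_into S n. count p k * k + N \<le> n}"
  have u: "u t + n mod x + Suc x * (N + t) = n div x" "N \<le> u t" if "t < Q" for t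
  proof -
    have "x + Suc x * (N + Q) + N \<le> n div x"
      using n assms by (simp add: less_eq_div_iff_mult_less_eq mult.commute)
    moreover have "n mod x < x" using assms by simp
    moreover have "Suc x * (N + t) \<le> Suc x * (N + Q)" using that by (intro mult_le_mono) auto
    ultimately show "u t + n mod x + Suc x * (N + t) = n div x" "N \<le> u t"
      unfolding u_def by linarith+
  qed
  have uv: "u t * x + v t * Suc x = n" if "t < Q" for t
  proof -
    have "u t * x + v t * Suc x = (u t + n mod x + Suc x * (N + t)) * x + n mod x"
      unfolding v_def by (simp add: algebra_simps)
    then show ?thesis using u[OF that] by simp
  qed
  have "f t \<in> ?A" if t: "t < Q" for t
  proof -
    have "N \<le> u t * x"
      using mult_le_mono[OF u(2)[OF t], of 1 x] assms by simp
    moreover have "N \<le> v t * Suc x"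
    proof -
      have "1 * N \<le> x * (N + t)" using assms by (intro mult_le_mono) auto
      then have "N \<le> v t" by (simp add: v_def)
      then show ?thesis by simp
    qed
    moreover have "count (f t) k * k = (if k = x then u t * x else if k = Suc x then v t * Suc x else 0)"
      by (auto simp: f_def)
    ultimately have "count (f t) k * k + N \<le> n"
      using uv[OF t] by (auto split: if_splits)
    then show ?thesis using uv[OF t] S by (auto simp: f_def partitions_into_def)
  qed
  moreover have "inj_on f {..<Q}"
  proof (rule inj_onI)
    fix t t' assume "f t = f t'"
    then have "count (f t) (Suc x) = count (f t') (Suc x)" by simp
    then show "t = t'" using assms by (simp add: f_def v_def)
  qed
  moreover have "finite ?A" using finite_partitions_into[OF S(1)] by simp
  ultimately show "Q \<le> card ?A"
    using card_inj_on_le[of f "{..<Q}" ?A] by auto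
qed

section \<open>Translation of the two counts and conclusion\<close>

lemma c2_count_eq: "c2_count L s n = card (partitions_into {s+1..s+L} n)"
proof -
  have "\<forall>i\<in>#p. 1 \<le> i" if "set_mset p \<subseteq> {s+1..s+L}" for p
    using that by auto
  then show ?thesis
    unfolding c2_count_def partitions_def partitions_into_def
    by (intro arg_cong[of _ _ card]) blast
qed

lemma f_count_eq:
  assumes "s \<ge> 1" "s < k"
  shows "f_count L s k n = card {p \<in> partitions_into (insert s ({s+1..s+L} - {k})) n. s \<in># p}"
  unfolding f_count_def
proof (rule arg_cong[of _ _ card], rule set_eqI)
  fix p
  let ?S = "insert s ({s+1..s+L} - {k})"
  have "(Min (set_mset p) = s \<and> Max (set_mset p) \<le> L + s \<and> k \<notin># p \<and> p \<noteq> {#} \<and> (\<forall>i\<in>#p. 1 \<le> i))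
     \<longleftrightarrow> (set_mset p \<subseteq> ?S \<and> s \<in># p)"
  proof (cases "p = {#}")
    case False
    then have ne: "set_mset p \<noteq> {}" by simp
    have E1: "Min (set_mset p) = s \<longleftrightarrow> s \<in># p \<and> (\<forall>i\<in>#p. s \<le> i)"
      using ne by (metis Min_eq_iff finite_set_mset)
    have E2: "Max (set_mset p) \<le> L + s \<longleftrightarrow> (\<forall>i\<in>#p. i \<le> L + s)"
      using ne by simp
    have E3: "set_mset p \<subseteq> ?S \<longleftrightarrow> (\<forall>i\<in>#p. s \<le> i \<and> i \<le> L + s) \<and> k \<notin># p"
      using assms by (force simp: subset_iff)
    show ?thesis
      unfolding E1 E2 E3 using False le_trans[OF assms(1)] by blast
  qed auto
  then show "p \<in> {p \<in> partitions n. p \<noteq> {#} \<and> Min (set_mset p) = s \<and> Max (set_mset p) \<le> L + s \<and> k \<notin># p}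
    \<longleftrightarrow> p \<in> {p \<in> partitions_into ?S n. s \<in># p}"
    by (auto simp: partitions_def partitions_into_def)
qed

theorem theorem1p1:
  fixes s :: nat
  assumes "s \<ge> 1"
  shows "\<exists>M::nat. \<forall>L k n :: nat.
           L \<ge> 3 \<longrightarrow> max (s + 1) L \<le> k \<longrightarrow> k \<le> s + L \<longrightarrow> n \<ge> M \<longrightarrow>
             f_count L s k n \<ge> c2_count L s n"
proof -
  define smooth where "smooth M x g \<longleftrightarrow> (\<forall>S n w. 0 \<notin> S \<longrightarrow> x \<in> S \<longrightarrow> x + g \<in> S \<longrightarrow>
      g = 1 \<or> S = {x, x + g} \<longrightarrow> M \<le> n \<longrightarrow> w \<le> 2 * s \<longrightarrow>
      (2 * s + 1) * card (partitions_into S n) \<le> (2 * s + 2) * card (partitions_into S (n - g * w)))"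
    for M x g
  have smooth_ex: "\<exists>M. smooth M x g" if "x > 0" "g > 0" for x g
    unfolding smooth_def by (rule card_partitions_into_smooth[OF that])
  \<comment> \<open>These four pairs of \<open>x\<close> and \<open>g\<close> serve all
    \<open>L\<close> and \<open>k\<close> and depend on \<open>s\<close> only, hence so does
    \<open>M\<close>.\<close>
  obtain M1 M2 M3 M4 where Ms: "smooth M1 (s + 2) 1" "smooth M2 (s + 1) 2" "smooth M3 (s + 3) 1" "smooth M4 (s + 1) 1"
    using smooth_ex[of "s + 2" 1] smooth_ex[of "s + 1" 2] smooth_ex[of "s + 3" 1] smooth_ex[of "s + 1" 1]
    by auto
  define M where "M = M1 + M2 + M3 + M4"
  have smooth_mono: "smooth M' x g" if "smooth M x g" "M \<le> M'" for M M' x g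
    unfolding smooth_def
    by (intro allI impI, rule that(1)[unfolded smooth_def, rule_format]) (use that(2) in auto)
  have sm: "smooth M (s + 2) 1" "smooth M (s + 1) 2" "smooth M (s + 3) 1" "smooth M (s + 1) 1"
    using Ms by (auto elim!: smooth_mono simp: M_def)
  define N where "N = M + 4 * s"
  define K where "K = card (\<Union>m<N. partitions_into {1..} m)"
  obtain M' where M': "\<And>S k n. \<lbrakk>0 \<notin> S; s + 1 \<in> S; Suc (s + 1) \<in> S; M' \<le> n\<rbrakk> \<Longrightarrow>
      2 * s * K \<le> card {p \<in> partitions_into S n. count p k * k + N \<le> n}"
    using card_partitions_into_unbounded[of "s + 1" "2 * s * K" N] by auto
  show ?thesis
  proof (intro exI allI impI)
    fix L k n :: nat
    assume L: "3 \<le> L" and "max (s + 1) L \<le> k" and ks: "k \<le> s + L" and n: "M' \<le> n"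
    then have k: "s < k" by simp
    define S where "S = {s+1..s+L} - {k}"
    have ins: "insert k S = {s+1..s+L}" using k ks by (auto simp: S_def)
    obtain x g where xg: "smooth M x g" "x \<in> S" "x + g \<in> S" "g = 1 \<or> S = {x, x + g}" "g = 1 \<or> g = 2 \<and> k = s + 2"
    proof -
      \<comment> \<open>Two consecutive elements of \<open>S\<close> are available unless
        \<open>k = s + 2\<close> and \<open>L = 3\<close>, where \<open>S = {s + 1, s + 3}\<close>
        forces \<open>g = 2\<close>.\<close>
      consider "k = s + 1" | "k = s + 2" "L = 3" | "k = s + 2" "L \<ge> 4" | "k \<ge> s + 3"
        using k L by linarith
      then show ?thesis
      proof cases
        case 1
        show ?thesis by (rule that[OF sm(1)]) (use 1 L in \<open>auto simp: S_def\<close>)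
      next
        case 2
        show ?thesis by (rule that[OF sm(2)]) (use 2 in \<open>auto simp: S_def\<close>)
      next
        case 3
        show ?thesis by (rule that[OF sm(3)]) (use 3 in \<open>auto simp: S_def\<close>)
      next
        case 4
        show ?thesis by (rule that[OF sm(4)]) (use 4 L in \<open>auto simp: S_def\<close>)
      qed
    qed
    let ?P = "partitions_into {s+1..s+L} n" and ?F = "card {p \<in> partitions_into (insert s S) n. s \<in># p}"
    let ?C = "card {p \<in> ?P. count p k * k + N \<le> n}"
    have "(2 * s + 1) * ?C \<le> 2 * s * ?F"
      unfolding N_def ins[symmetric]
    proof (rule card_partitions_compare_missing_part[OF assms k xg(5)])
      show S0: "0 \<notin> S" and "s \<notin> S" and "k \<notin> S" by (auto simp: S_def)
      show "(2 * s + 1) * card (partitions_into S n) \<le> (2 * s + 2) * card (partitions_into S (n - g * w))"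
        if "M \<le> n" "w \<le> 2 * s" for n w
        by (rule xg(1)[unfolded smooth_def, rule_format, OF S0 xg(2-4) that])
    qed
    \<comment> \<open>Of the \<open>2 * s + 1\<close> copies of \<open>?C\<close> on the left, the
      spare one pays for \<open>2 * s * K\<close>, and \<open>K\<close> bounds the number of
      partitions left out of \<open>?C\<close>.\<close>
    moreover have "2 * s * K \<le> ?C" using L n by (intro M') auto
    ultimately have "2 * s * (?C + K) \<le> 2 * s * ?F" by (simp add: algebra_simps)
    then have "?C + K \<le> ?F" using assms by simp
    moreover have "card {p \<in> ?P. n < count p k * k + N} \<le> K"
      unfolding K_def by (rule card_partitions_into_count_ge) simp
    moreover have "card ?P \<le> ?C + card {p \<in> ?P. n < count p k * k + N}"
    proof -
      have eq: "{p \<in> ?P. count p k * k + N \<le> n} \<union> {p \<in> ?P. n < count p k * k + N} = ?P" by auto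
      show ?thesis
        using card_Un_le[of "{p \<in> ?P. count p k * k + N \<le> n}" "{p \<in> ?P. n < count p k * k + N}"]
        unfolding eq .
    qed
    ultimately have "card ?P \<le> ?F" by linarith
    then show "c2_count L s n \<le> f_count L s k n"
      using f_count_eq[OF assms k] by (simp add: c2_count_eq S_def)
  qed
qed

end
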